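(* Let $G$ be a finite group. Then $G$ is autonilpotent if and only if every automorphism $\alpha$ of $G$ fixes all elements of $G$ whose orders are coprime to the order of $\alpha$.
   Context: All groups are finite. $\mathrm{Aut}\,G$ is the group of all automorphisms of $G$, and the order of an automorphism is its order as an element of $\mathrm{Aut}\,G$. For $x\in G$ and $\alpha\in\mathrm{Aut}\,G$, $x^\alpha$ denotes the image of $x$ under $\alpha$, $[x,\alpha]=x^{-1}x^\alpha$, and inductively $[x,\alpha_1,\dots,\alpha_n]=[[x,\alpha_1,\dots,\alpha_{n-1}],\alpha_n]$. For a natural number $n$ let $L_n(G)=\{x\in G \mid [x,\alpha_1,\dots,\alpha_n]=1 \text{ for all } \alpha_1,\dots,\alpha_n\in\mathrm{Aut}\,G\}$. The group $G$ is called autonilpotent if $G=L_n(G)$ for some natural number $n$. *)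

theory Defs
  imports "HOL-Algebra.Algebra"
begin

definition autocommutator :: "('a, 'b) monoid_scheme \<Rightarrow> 'a \<Rightarrow> ('a \<Rightarrow> 'a) \<Rightarrow> 'a"
  where "autocommutator G x \<alpha> = inv\<^bsub>G\<^esub> x \<otimes>\<^bsub>G\<^esub> \<alpha> x"

text \<open>
  The left-normed autocommutator \<open>[x, \<alpha>\<^sub>1, \<dots>, \<alpha>\<^sub>n]\<close>, with the automorphisms given as a list;
  for the empty list it is \<open>x\<close>.
\<close>

definition autocommutators :: "('a, 'b) monoid_scheme \<Rightarrow> 'a \<Rightarrow> ('a \<Rightarrow> 'a) list \<Rightarrow> 'a"
  where "autocommutators G x \<alpha>s = foldl (autocommutator G) x \<alpha>s"

lemma autocommutators_Nil: "autocommutators G x [] = x"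
  by (simp add: autocommutators_def)

lemma autocommutators_snoc:
  "autocommutators G x (\<alpha>s @ [\<alpha>]) = autocommutator G (autocommutators G x \<alpha>s) \<alpha>"
  by (simp add: autocommutators_def)

definition autocentre :: "nat \<Rightarrow> ('a, 'b) monoid_scheme \<Rightarrow> 'a set"
  where "autocentre n G =
    {x \<in> carrier G. \<forall>\<alpha>s. length \<alpha>s = n \<and> set \<alpha>s \<subseteq> carrier (AutoGroup G) \<longrightarrow>
       autocommutators G x \<alpha>s = \<one>\<^bsub>G\<^esub>}"

text \<open>
  Allowing \<open>n = 0\<close> makes no difference: \<open>autocentre 0 G\<close> is the trivial subgroup, so it
  equals \<open>carrier G\<close> only when \<open>G\<close> is trivial, and then \<open>autocentre 1 G = carrier G\<close> as well.
\<close>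

definition autonilpotent :: "('a, 'b) monoid_scheme \<Rightarrow> bool"
  where "autonilpotent G \<longleftrightarrow> (\<exists>n. carrier G = autocentre n G)"

end

theory Submission
  imports Defs
begin

text \<open>
  Write \<open>A\<close> for the automorphism group of \<open>G\<close>, acting on the left, and \<open>L\<^sub>n\<close> for
  \<open>autocentre n G\<close>. An element lies in \<open>L\<^sub>n\<^sub>+\<^sub>1\<close> exactly when every automorphism fixes its
  coset modulo \<open>L\<^sub>n\<close>, so the \<open>L\<^sub>n\<close> form an ascending chain of characteristic subgroups, an
  upper central series relative to the whole of \<open>A\<close>.

  Suppose that \<open>G\<close> is autonilpotent and that \<open>x\<close> and \<open>\<alpha>\<close> have coprime orders, and put
  \<open>z = [x, \<alpha>]\<close>, so \<open>\<alpha> x = x z\<close>. Let \<open>z \<in> L\<^sub>n\<^sub>+\<^sub>1\<close>. Modulo \<open>L\<^sub>n\<close> the element \<open>z\<close> is fixed by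
  \<open>\<alpha>\<close>, whence \<open>\<alpha>\<^sup>k x = x z\<^sup>k\<close>, and by conjugation with \<open>x\<close>, whence \<open>(x z)\<^sup>k = x\<^sup>k z\<^sup>k\<close>. The
  first equation shows that the order of \<open>z\<close> modulo \<open>L\<^sub>n\<close> divides the order of \<open>\<alpha>\<close>, the
  second that it divides the order of \<open>x\<close>. Hence \<open>z \<in> L\<^sub>n\<close>
  (\<open>autocommutator_descends\<close>), and descending the chain gives \<open>z = 1\<close>. This is the usual
  proof that elements of coprime order commute in a nilpotent group, carried out in the
  semidirect product of \<open>G\<close> with \<open>A\<close>.

  Conversely, assume that automorphisms fix the elements of order coprime to theirs. As
  \<open>G\<close> is finite, it is enough that \<open>L\<^sub>n\<^sub>+\<^sub>1\<close> is larger than \<open>N = L\<^sub>n\<close> whenever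
  \<open>N \<noteq> G\<close> (\<open>fixed_mod_grows\<close>). Pick a prime \<open>p\<close> dividing the index of \<open>N\<close> and a Sylow
  \<open>p\<close>-subgroup \<open>B\<close> of \<open>A\<close>. The number of cosets of \<open>N\<close> fixed by the \<open>p\<close>-group \<open>B\<close> is
  divisible by \<open>p\<close>; so the group \<open>F\<close> formed by these cosets has a Sylow \<open>p\<close>-subgroup
  that is too large to be contained in \<open>N\<close>, and some \<open>p\<close>-element \<open>x\<close> of \<open>F\<close> lies outside
  \<open>N\<close>. The stabilizer in \<open>A\<close> of the coset of \<open>x\<close> contains \<open>B\<close>, and by hypothesis it
  contains the Sylow \<open>q\<close>-subgroups for all primes \<open>q \<noteq> p\<close>, whose elements even fix \<open>x\<close>.
  So it is all of \<open>A\<close>, and \<open>x\<close> belongs to \<open>L\<^sub>n\<^sub>+\<^sub>1\<close> but not to \<open>L\<^sub>n\<close>.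
\<close>

section \<open>Sylow subgroups and fixed points of p-groups\<close>

lemma (in group) ord_dvd_card_subgroup:
  assumes "subgroup S G" and "y \<in> S"
  shows "ord y dvd card S"
proof -
  interpret S: group "G\<lparr>carrier := S\<rparr>"
    using assms(1) by (rule subgroup_imp_group)
  have "y [^]\<^bsub>G\<lparr>carrier := S\<rparr>\<^esub> order (G\<lparr>carrier := S\<rparr>) = \<one>\<^bsub>G\<lparr>carrier := S\<rparr>\<^esub>"
    by (rule S.pow_order_eq_1) (use assms in simp)
  hence "y [^] card S = \<one>"
    by (simp add: order_def nat_pow_consistent[symmetric])
  moreover have "y \<in> carrier G"
    using assms subgroup.mem_carrier by fast
  ultimately show ?thesis
    by (simp add: pow_eq_id)
qed

lemma (in group) sylow_subgroup_exists:
  assumes "finite (carrier G)" and "Factorial_Ring.prime p"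
  obtains S where "subgroup S G" and "card S = p ^ multiplicity p (order G)"
proof -
  obtain m where "order G = p ^ multiplicity p (order G) * m"
    using multiplicity_dvd[of p "order G"] by (elim dvdE)
  thus thesis
    using sylow_thm[of p G] assms that by (metis is_group)
qed

lemma (in group) card_subgroup_dvd_of_subset:
  assumes "subgroup S G" "subgroup T G" and "S \<subseteq> T"
  shows "card S dvd card T"
proof -
  interpret T: group "G\<lparr>carrier := T\<rparr>"
    using assms(2) by (rule subgroup_imp_group)
  have "subgroup S (G\<lparr>carrier := T\<rparr>)"
    using assms by (simp add: subgroup_incl)
  from T.lagrange[OF this] show ?thesis
    by (simp add: order_def) (metis dvd_triv_right)
qed

text \<open>
  For every prime, the full power dividing the order of the group already divides the
  order of the subgroup.
\<close>
lemma (in group) subgroup_eq_carrier_of_sylows: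
  assumes fin: "finite (carrier G)" and T: "subgroup T G"
    and sylow: "\<And>q. Factorial_Ring.prime q \<Longrightarrow>
      \<exists>S. subgroup S G \<and> S \<subseteq> T \<and> card S = q ^ multiplicity q (order G)"
  shows "T = carrier G"
proof -
  have "card T \<noteq> 0"
    using T fin by (metis subgroup.finite_imp_card_positive less_irrefl)
  moreover have "order G \<noteq> 0"
    using fin by (simp add: order_gt_0_iff_finite)
  moreover have "multiplicity q (order G) \<le> multiplicity q (card T)" if q: "Factorial_Ring.prime q" for q
  proof -
    obtain S where "subgroup S G" "S \<subseteq> T" "card S = q ^ multiplicity q (order G)"
      using sylow[OF q] by blast
    hence "q ^ multiplicity q (order G) dvd card T"
      using card_subgroup_dvd_of_subset T by metis
    thus ?thesis
      using q \<open>card T \<noteq> 0\<close> by (intro multiplicity_geI) (auto simp: prime_gt_Suc_0_nat)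
  qed
  ultimately have "order G dvd card T"
    by (intro multiplicity_le_imp_dvd) auto
  hence "card (carrier G) \<le> card T"
    using \<open>card T \<noteq> 0\<close> by (simp add: order_def dvd_imp_le)
  thus ?thesis
    using fin T subgroup.subset by (metis card_seteq)
qed

text \<open>
  Orbit lengths divide the order of the \<open>p\<close>-group, so every orbit that is not a single
  fixed point has length divisible by \<open>p\<close>.
\<close>
lemma (in group_action) card_fixed_points_mod_prime:
  assumes p: "Factorial_Ring.prime p" and card_G: "order G = p ^ k" and fin: "finite E"
  shows "card {x \<in> E. \<forall>g \<in> carrier G. \<phi> g x = x} mod p = card E mod p"
proof -
  define Fix where "Fix = {x \<in> E. \<forall>g \<in> carrier G. \<phi> g x = x}"
  interpret group G
    using group_hom by (rule group_hom.axioms(1))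
  \<comment> \<open>Summed over all orbits, the sum below counts the points that are not fixed.\<close>
  have "p dvd (\<Sum>x\<in>orb. if x \<in> Fix then 0 else 1)" if orb: "orb \<in> orbits G E \<phi>" for orb
  proof -
    obtain x where x: "x \<in> E" "orb = orbit G \<phi> x"
      using orb by (auto simp: orbits_def)
    have orb_E: "orb \<subseteq> E"
      using x element_image by (auto simp: orbit_def)
    have "card orb dvd p ^ k"
      using orbit_stabilizer_theorem[OF x(1)] card_G x(2) by (metis dvd_triv_left)
    then obtain j where j: "card orb = p ^ j"
      using p by (auto simp: divides_primepow_nat)
    show ?thesis
    proof (cases "j = 0")
      case True
      hence "card orb = 1" using j by simp
      hence "orb = {x}"
        using orbit_refl[OF x(1)] x(2) by (metis card_1_singletonE singletonD)
      hence "x \<in> Fix"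
        using x by (auto simp: Fix_def orbit_def)
      thus ?thesis using \<open>orb = {x}\<close> by simp
    next
      case False
      have "y \<notin> Fix" if y: "y \<in> orb" for y
      proof
        assume "y \<in> Fix"
        have "orb = orbit G \<phi> y"
        proof -
          have "orbit G \<phi> y \<in> orbits G E \<phi>" "y \<in> orbit G \<phi> y"
            using y orb_E orbit_refl by (auto simp: orbits_def)
          thus ?thesis using disjoint_union orb y by blast
        qed
        also have "\<dots> = {y}"
        proof -
          have "\<phi> g y = y" if "g \<in> carrier G" for g
            using \<open>y \<in> Fix\<close> that by (simp add: Fix_def)
          thus ?thesis using one_closed unfolding orbit_def by force
        qed
        finally have "p ^ j = 1" using j by simp
        thus False using False p by (simp add: prime_gt_1_nat)
      qed
      hence "(\<Sum>x\<in>orb. if x \<in> Fix then 0 else 1) = (\<Sum>x\<in>orb. 1 :: nat)"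
        by (intro sum.cong) auto
      hence "(\<Sum>x\<in>orb. if x \<in> Fix then 0 else 1) = card orb" by simp
      thus ?thesis using False j by simp
    qed
  qed
  hence "p dvd (\<Sum>orb\<in>orbits G E \<phi>. \<Sum>x\<in>orb. if x \<in> Fix then 0 else 1)"
    by (rule dvd_sum)
  also have "\<dots> = (\<Sum>x\<in>E. if x \<in> Fix then 0 else 1)"
    by (rule disjoint_sum[OF fin])
  also have "\<dots> = (\<Sum>x\<in>E - Fix. 1)"
    by (intro sum.mono_neutral_cong_right fin) auto
  also have "\<dots> = card (E - Fix)" by simp
  also have "\<dots> = card E - card Fix"
    using fin by (intro card_Diff_subset) (auto simp: Fix_def)
  finally have "p dvd card E - card Fix" .
  moreover have "card Fix \<le> card E"
    using fin by (intro card_mono) (auto simp: Fix_def)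
  ultimately show ?thesis
    unfolding Fix_def[symmetric] by (metis mod_eq_dvd_iff_nat)
qed

section \<open>The automorphism group\<close>

context group
begin

lemma AutoGroup_carrier: "carrier (AutoGroup G) = hom G G \<inter> Bij (carrier G)"
  by (simp add: AutoGroup_def auto_def)

lemma AutoGroup_hom: "\<alpha> \<in> carrier (AutoGroup G) \<Longrightarrow> \<alpha> \<in> hom G G"
  by (simp add: AutoGroup_carrier)

lemma AutoGroup_group_hom: "\<alpha> \<in> carrier (AutoGroup G) \<Longrightarrow> group_hom G G \<alpha>"
  by (simp add: AutoGroup_hom group_hom_def group_hom_axioms_def is_group)

lemma AutoGroup_closed: "\<lbrakk>\<alpha> \<in> carrier (AutoGroup G); x \<in> carrier G\<rbrakk> \<Longrightarrow> \<alpha> x \<in> carrier G"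
  using group_hom.hom_closed[OF AutoGroup_group_hom] by blast

lemma AutoGroup_one: "x \<in> carrier G \<Longrightarrow> \<one>\<^bsub>AutoGroup G\<^esub> x = x"
  by (simp add: AutoGroup_def BijGroup_def)

lemma AutoGroup_mult:
  assumes "\<alpha> \<in> carrier (AutoGroup G)" "\<beta> \<in> carrier (AutoGroup G)" "x \<in> carrier G"
  shows "(\<alpha> \<otimes>\<^bsub>AutoGroup G\<^esub> \<beta>) x = \<alpha> (\<beta> x)"
  using assms by (simp add: AutoGroup_def BijGroup_def auto_def compose_eq)

lemma AutoGroup_inv:
  assumes "\<alpha> \<in> carrier (AutoGroup G)" "x \<in> carrier G"
  shows "\<alpha> ((inv\<^bsub>AutoGroup G\<^esub> \<alpha>) x) = x" "(inv\<^bsub>AutoGroup G\<^esub> \<alpha>) (\<alpha> x) = x"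
proof -
  interpret A: group "AutoGroup G" by (rule AutoGroup)
  show "\<alpha> ((inv\<^bsub>AutoGroup G\<^esub> \<alpha>) x) = x"
    using AutoGroup_mult[of \<alpha> "inv\<^bsub>AutoGroup G\<^esub> \<alpha>" x] assms by (simp add: AutoGroup_one)
  show "(inv\<^bsub>AutoGroup G\<^esub> \<alpha>) (\<alpha> x) = x"
    using AutoGroup_mult[of "inv\<^bsub>AutoGroup G\<^esub> \<alpha>" \<alpha> x] assms by (simp add: AutoGroup_one)
qed

lemma finite_AutoGroup:
  assumes "finite (carrier G)"
  shows "finite (carrier (AutoGroup G))"
proof (rule finite_subset)
  show "carrier (AutoGroup G) \<subseteq> (\<Pi>\<^sub>E x\<in>carrier G. carrier G)"
    by (auto simp: AutoGroup_carrier Bij_def hom_def PiE_def)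
  show "finite (\<Pi>\<^sub>E x\<in>carrier G. carrier G)"
    using assms by (intro finite_PiE)
qed

lemma conjugation_in_AutoGroup:
  assumes g: "g \<in> carrier G"
  shows "(\<lambda>x\<in>carrier G. g \<otimes> x \<otimes> inv g) \<in> carrier (AutoGroup G)"
proof -
  have "g \<otimes> (x \<otimes> y) \<otimes> inv g = g \<otimes> x \<otimes> inv g \<otimes> (g \<otimes> y \<otimes> inv g)"
    if "x \<in> carrier G" "y \<in> carrier G" for x y
    using g that by (simp add: m_assoc inv_solve_left)
  hence "(\<lambda>x\<in>carrier G. g \<otimes> x \<otimes> inv g) \<in> hom G G"
    using g by (auto simp: hom_def)
  thus ?thesis
    using conjugation_is_bij[OF g] by (auto simp: AutoGroup_carrier Bij_def)
qed

end

section \<open>Characteristic subgroups and elements fixed modulo them\<close>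

definition characteristic_subgroup :: "'a set \<Rightarrow> ('a, 'b) monoid_scheme \<Rightarrow> bool"
  where "characteristic_subgroup N G \<longleftrightarrow>
    subgroup N G \<and> (\<forall>\<alpha> \<in> carrier (AutoGroup G). \<alpha> ` N \<subseteq> N)"

text \<open>
  For normal \<open>B\<close>-invariant \<open>N\<close>, this is the preimage in \<open>G\<close> of the fixed points of \<open>B\<close> on the quotient
  by \<open>N\<close>. The set \<open>B\<close> is a parameter because the growth argument uses both a Sylow subgroup
  of the automorphism group and the whole automorphism group.
\<close>
definition fixed_mod :: "('a, 'b) monoid_scheme \<Rightarrow> 'a set \<Rightarrow> ('a \<Rightarrow> 'a) set \<Rightarrow> 'a set"
  where "fixed_mod G N B = {x \<in> carrier G. \<forall>\<alpha> \<in> B. autocommutator G x \<alpha> \<in> N}"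

context group
begin

lemma characteristic_imp_normal:
  assumes "characteristic_subgroup N G"
  shows "N \<lhd> G"
proof -
  have N: "subgroup N G" using assms by (simp add: characteristic_subgroup_def)
  moreover have "g \<otimes> h \<otimes> inv g \<in> N" if "g \<in> carrier G" "h \<in> N" for g h
  proof -
    have "(\<lambda>x\<in>carrier G. g \<otimes> x \<otimes> inv g) h \<in> N"
      using assms conjugation_in_AutoGroup[OF that(1)] that(2)
      unfolding characteristic_subgroup_def by blast
    thus ?thesis using subgroup.mem_carrier[OF N that(2)] by simp
  qed
  ultimately show ?thesis by (simp add: normal_inv_iff)
qed

text \<open>
  The autocommutator is a quotient of the form \<open>x\<^sup>-\<^sup>1 y\<close>, which would describe left cosets;
  normality makes right cosets, and hence the quotient group, available.
\<close>
lemma autocommutator_mem_iff: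
  assumes "N \<lhd> G" and \<alpha>: "\<alpha> \<in> carrier (AutoGroup G)" and x: "x \<in> carrier G"
  shows "autocommutator G x \<alpha> \<in> N \<longleftrightarrow> N #> \<alpha> x = N #> x"
proof -
  interpret normal N G by fact
  note \<alpha>x = AutoGroup_closed[OF \<alpha> x]
  have "inv x \<otimes> \<alpha> x \<in> N \<longleftrightarrow> N #> (inv x \<otimes> \<alpha> x) = N"
    using x \<alpha>x coset_join1[of N "inv x \<otimes> \<alpha> x"] coset_join2[of "inv x \<otimes> \<alpha> x" N] subgroup_axioms
    by blast
  also have "\<dots> \<longleftrightarrow> N #> x <#> (N #> (inv x \<otimes> \<alpha> x)) = N #> x <#> N"
  proof -
    interpret Q: group "G Mod N" by (rule factorgroup_is_group)
    have "N #> x \<in> carrier (G Mod N)" "N #> (inv x \<otimes> \<alpha> x) \<in> carrier (G Mod N)"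
      "N \<in> carrier (G Mod N)"
      using x \<alpha>x Q.one_closed by (auto simp: carrier_FactGroup)
    thus ?thesis using Q.l_cancel by (metis mult_FactGroup)
  qed
  also have "\<dots> \<longleftrightarrow> N #> \<alpha> x = N #> x"
    using x \<alpha>x rcos_sum[of x "inv x \<otimes> \<alpha> x"] rcos_sum[of x "\<one>"]
    by (simp add: m_assoc[symmetric] subset)
  finally show ?thesis by (simp add: autocommutator_def)
qed

lemma automorphism_image_coset:
  assumes "characteristic_subgroup N G" and \<alpha>: "\<alpha> \<in> carrier (AutoGroup G)"
    and x: "x \<in> carrier G"
  shows "\<alpha> ` (N #> x) = N #> \<alpha> x"
proof -
  interpret A: group "AutoGroup G" by (rule AutoGroup)
  have N: "N \<subseteq> carrier G"
    using assms(1) by (simp add: characteristic_subgroup_def subgroup.subset)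
  have image_N: "\<alpha> ` N = N"
  proof
    show "\<alpha> ` N \<subseteq> N"
      using assms by (simp add: characteristic_subgroup_def)
    show "N \<subseteq> \<alpha> ` N"
    proof
      fix y assume y: "y \<in> N"
      hence "(inv\<^bsub>AutoGroup G\<^esub> \<alpha>) y \<in> N"
        using assms by (auto simp: characteristic_subgroup_def)
      moreover have "\<alpha> ((inv\<^bsub>AutoGroup G\<^esub> \<alpha>) y) = y"
        using AutoGroup_inv(1) \<alpha> y N by blast
      ultimately show "y \<in> \<alpha> ` N" by (metis imageI)
    qed
  qed
  have "\<alpha> (n \<otimes> x) = \<alpha> n \<otimes> \<alpha> x" if "n \<in> N" for n
    using AutoGroup_hom[OF \<alpha>] N x that by (auto intro: hom_mult)
  hence "\<alpha> ` (N #> x) = \<alpha> ` N #> \<alpha> x"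
    by (auto simp: r_coset_def image_UN)
  thus ?thesis by (simp add: image_N)
qed

lemma subgroup_fixed_mod:
  assumes N: "N \<lhd> G" and B: "B \<subseteq> carrier (AutoGroup G)"
  shows "subgroup (fixed_mod G N B) G"
proof -
  interpret normal N G by fact
  interpret Q: group "G Mod N" by (rule factorgroup_is_group)
  have mem: "x \<in> fixed_mod G N B \<longleftrightarrow> x \<in> carrier G \<and> (\<forall>\<alpha>\<in>B. N #> \<alpha> x = N #> x)" for x
    using autocommutator_mem_iff[OF N] B by (auto simp: fixed_mod_def)
  show ?thesis
  proof (rule subgroupI)
    show "fixed_mod G N B \<subseteq> carrier G" by (auto simp: fixed_mod_def)
    have "\<forall>\<alpha>\<in>B. N #> \<alpha> \<one> = N #> \<one>"
    proof
      fix \<alpha> assume "\<alpha> \<in> B"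
      hence "\<alpha> \<one> = \<one>" using group_hom.hom_one[OF AutoGroup_group_hom] B by blast
      thus "N #> \<alpha> \<one> = N #> \<one>" by simp
    qed
    hence "\<one> \<in> fixed_mod G N B" by (simp add: mem)
    thus "fixed_mod G N B \<noteq> {}" by blast
  next
    fix x assume "x \<in> fixed_mod G N B"
    hence x: "x \<in> carrier G" "\<And>\<alpha>. \<alpha> \<in> B \<Longrightarrow> N #> \<alpha> x = N #> x" by (auto simp: mem)
    have "N #> \<alpha> (inv x) = N #> inv x" if "\<alpha> \<in> B" for \<alpha>
    proof -
      have \<alpha>: "\<alpha> \<in> carrier (AutoGroup G)" using that B by blast
      have "N #> \<alpha> (inv x) = set_inv (N #> \<alpha> x)"
        using group_hom.hom_inv[OF AutoGroup_group_hom[OF \<alpha>] x(1)] AutoGroup_closed[OF \<alpha> x(1)]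
        by (simp add: rcos_inv)
      thus ?thesis using x that by (simp add: rcos_inv)
    qed
    thus "inv x \<in> fixed_mod G N B" using x by (simp add: mem)
  next
    fix x y assume "x \<in> fixed_mod G N B" "y \<in> fixed_mod G N B"
    hence x: "x \<in> carrier G" "\<And>\<alpha>. \<alpha> \<in> B \<Longrightarrow> N #> \<alpha> x = N #> x"
      and y: "y \<in> carrier G" "\<And>\<alpha>. \<alpha> \<in> B \<Longrightarrow> N #> \<alpha> y = N #> y" by (auto simp: mem)
    have "N #> \<alpha> (x \<otimes> y) = N #> (x \<otimes> y)" if "\<alpha> \<in> B" for \<alpha>
    proof -
      have \<alpha>: "\<alpha> \<in> carrier (AutoGroup G)" using that B by blast
      have "N #> \<alpha> (x \<otimes> y) = (N #> \<alpha> x) <#> (N #> \<alpha> y)"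
        using hom_mult[OF AutoGroup_hom[OF \<alpha>] x(1) y(1)] AutoGroup_closed[OF \<alpha>] x(1) y(1)
        by (simp add: rcos_sum)
      thus ?thesis using x y that by (simp add: rcos_sum)
    qed
    thus "x \<otimes> y \<in> fixed_mod G N B" using x y by (simp add: mem)
  qed
qed

lemma subset_fixed_mod:
  assumes "characteristic_subgroup N G" and "B \<subseteq> carrier (AutoGroup G)"
  shows "N \<subseteq> fixed_mod G N B"
  using assms
  by (auto simp: characteristic_subgroup_def fixed_mod_def autocommutator_def
      intro!: subgroup.m_closed subgroup.m_inv_closed subgroup.mem_carrier)

text \<open>
  Being fixed by all automorphisms modulo \<open>N\<close> passes from \<open>x\<close> to \<open>\<beta> x\<close>, because both
  \<open>\<alpha> (\<beta> x)\<close> and \<open>\<beta> x\<close> are congruent to \<open>x\<close>.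
\<close>
lemma characteristic_fixed_mod:
  assumes N: "characteristic_subgroup N G"
  shows "characteristic_subgroup (fixed_mod G N (carrier (AutoGroup G))) G"
proof -
  interpret A: group "AutoGroup G" by (rule AutoGroup)
  note nN = characteristic_imp_normal[OF N]
  have "\<beta> x \<in> fixed_mod G N (carrier (AutoGroup G))"
    if \<beta>: "\<beta> \<in> carrier (AutoGroup G)" and x: "x \<in> fixed_mod G N (carrier (AutoGroup G))" for \<beta> x
  proof -
    have xG: "x \<in> carrier G" using x by (simp add: fixed_mod_def)
    have fix_x: "N #> \<alpha> x = N #> x" if "\<alpha> \<in> carrier (AutoGroup G)" for \<alpha>
      using x that autocommutator_mem_iff[OF nN] by (auto simp: fixed_mod_def)
    have "N #> \<alpha> (\<beta> x) = N #> \<beta> x" if \<alpha>: "\<alpha> \<in> carrier (AutoGroup G)" for \<alpha>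
      using fix_x[OF A.m_closed[OF \<alpha> \<beta>]] fix_x[OF \<beta>] AutoGroup_mult[OF \<alpha> \<beta>] xG by simp
    thus ?thesis
      using autocommutator_mem_iff[OF nN] AutoGroup_closed[OF \<beta> xG]
      by (simp add: fixed_mod_def)
  qed
  thus ?thesis
    using subgroup_fixed_mod[OF nN subset_refl] by (auto simp: characteristic_subgroup_def)
qed

section \<open>Autocentres\<close>

lemma autocentre_0: "autocentre 0 G = {\<one>}"
  by (auto simp: autocentre_def autocommutators_def)

text \<open>
  In a left-normed autocommutator the first automorphism of the list acts first, so
  splitting it off expresses membership in one term of the series by membership of
  \<open>[x, \<alpha>]\<close> in the term before.
\<close>
lemma autocentre_Suc:
  "autocentre (Suc n) G = fixed_mod G (autocentre n G) (carrier (AutoGroup G))"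
proof (rule Set.set_eqI)
  fix x
  show "x \<in> autocentre (Suc n) G \<longleftrightarrow>
    x \<in> fixed_mod G (autocentre n G) (carrier (AutoGroup G))"
  proof (cases "x \<in> carrier G")
    case True
    hence comm: "autocommutator G x \<alpha> \<in> carrier G" if "\<alpha> \<in> carrier (AutoGroup G)" for \<alpha>
      using that AutoGroup_closed by (simp add: autocommutator_def)
    have "x \<in> autocentre (Suc n) G \<longleftrightarrow>
      (\<forall>\<alpha>\<in>carrier (AutoGroup G). \<forall>\<alpha>s. length \<alpha>s = n \<and> set \<alpha>s \<subseteq> carrier (AutoGroup G) \<longrightarrow>
         autocommutators G (autocommutator G x \<alpha>) \<alpha>s = \<one>)"
    proof -
      have "(\<forall>\<alpha>s. length \<alpha>s = Suc n \<and> set \<alpha>s \<subseteq> A \<longrightarrow> P \<alpha>s) \<longleftrightarrow>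
          (\<forall>\<alpha>\<in>A. \<forall>\<alpha>s. length \<alpha>s = n \<and> set \<alpha>s \<subseteq> A \<longrightarrow> P (\<alpha> # \<alpha>s))"
        for A and P :: "('a \<Rightarrow> 'a) list \<Rightarrow> bool"
        by (auto simp: length_Suc_conv)
      thus ?thesis
        using True by (simp add: autocentre_def autocommutators_def)
    qed
    thus ?thesis
      using True comm by (auto simp: fixed_mod_def autocentre_def)
  qed (auto simp: autocentre_def fixed_mod_def)
qed

lemma characteristic_autocentre: "characteristic_subgroup (autocentre n G) G"
proof (induction n)
  case 0
  show ?case
    using group_hom.hom_one[OF AutoGroup_group_hom]
    by (auto simp: autocentre_0 characteristic_subgroup_def triv_subgroup)
next
  case (Suc n)
  thus ?case by (simp add: autocentre_Suc characteristic_fixed_mod)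
qed

section \<open>Coprime orders in an autonilpotent group\<close>

text \<open>
  The order of \<open>z = [x, \<alpha>]\<close> modulo \<open>N\<close> divides both of the coprime orders: it divides the
  order of \<open>x\<close> because \<open>\<alpha> x = x z\<close> has the same order as \<open>x\<close>, while \<open>x\<close> and \<open>z\<close> commute
  modulo \<open>N\<close>; it divides the order of \<open>\<alpha>\<close> because \<open>\<alpha>\<^sup>k x\<close> is congruent to \<open>x z\<^sup>k\<close>.
\<close>
lemma autocommutator_descends:
  assumes char: "characteristic_subgroup N G" and x: "x \<in> carrier G"
    and \<alpha>: "\<alpha> \<in> carrier (AutoGroup G)"
    and cop: "coprime (ord x) (group.ord (AutoGroup G) \<alpha>)"
    and z_fixed: "autocommutator G x \<alpha> \<in> fixed_mod G N (carrier (AutoGroup G))"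
  shows "autocommutator G x \<alpha> \<in> N"
proof -
  interpret A: group "AutoGroup G" by (rule AutoGroup)
  interpret normal N G using char by (rule characteristic_imp_normal)
  interpret Q: group "G Mod N" by (rule factorgroup_is_group)
  define z where "z = autocommutator G x \<alpha>"
  note \<alpha>x = AutoGroup_closed[OF \<alpha> x]
  have z: "z \<in> carrier G"
    using x \<alpha>x by (simp add: z_def autocommutator_def)
  have \<alpha>x_eq: "\<alpha> x = x \<otimes> z"
    using x \<alpha>x by (simp add: z_def autocommutator_def m_assoc[symmetric])
  have fix_z: "N #> \<beta> z = N #> z" if "\<beta> \<in> carrier (AutoGroup G)" for \<beta>
    using z_fixed that autocommutator_mem_iff[OF normal_axioms that z]
    by (simp add: z_def fixed_mod_def)
  define Nx where "Nx = N #> x"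
  define Nz where "Nz = N #> z"
  have Nx_closed: "Nx \<in> carrier (G Mod N)" and Nz_closed: "Nz \<in> carrier (G Mod N)"
    using x z by (auto simp: Nx_def Nz_def carrier_FactGroup)
  have cos_mult: "N #> (a \<otimes> b) = (N #> a) \<otimes>\<^bsub>G Mod N\<^esub> (N #> b)"
    if "a \<in> carrier G" "b \<in> carrier G" for a b
    using that by (simp add: rcos_sum)
  \<comment> \<open>Conjugation by \<open>x\<close> is one of the automorphisms that fix \<open>z\<close> modulo \<open>N\<close>.\<close>
  have comm: "Nx \<otimes>\<^bsub>G Mod N\<^esub> Nz = Nz \<otimes>\<^bsub>G Mod N\<^esub> Nx"
  proof -
    have "N #> (x \<otimes> z \<otimes> inv x) = Nz"
      using fix_z[OF conjugation_in_AutoGroup[OF x]] z by (simp add: Nz_def)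
    hence "N #> (x \<otimes> z \<otimes> inv x \<otimes> x) = Nz \<otimes>\<^bsub>G Mod N\<^esub> Nx"
      using cos_mult[of "x \<otimes> z \<otimes> inv x" x] x z by (simp add: Nx_def)
    thus ?thesis
      using x z cos_mult[of x z] by (simp add: m_assoc Nx_def Nz_def)
  qed
  have "Q.ord Nz dvd ord x"
  proof -
    have "\<alpha> x [^] ord x = \<alpha> (x [^] ord x)"
      using group_hom.hom_nat_pow[OF AutoGroup_group_hom[OF \<alpha>] x] by simp
    also have "\<dots> = \<one>"
      using x AutoGroup_hom[OF \<alpha>] hom_one[OF _ is_group is_group] by simp
    finally have "(N #> \<alpha> x) [^]\<^bsub>G Mod N\<^esub> ord x = \<one>\<^bsub>G Mod N\<^esub>"
      using \<alpha>x by (simp add: FactGroup_pow subset)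
    moreover have "N #> \<alpha> x = Nx \<otimes>\<^bsub>G Mod N\<^esub> Nz"
      using \<alpha>x_eq cos_mult[OF x z] by (simp add: Nx_def Nz_def)
    moreover have "Nx [^]\<^bsub>G Mod N\<^esub> ord x = \<one>\<^bsub>G Mod N\<^esub>"
      using x by (simp add: Nx_def FactGroup_pow subset)
    ultimately have "Nz [^]\<^bsub>G Mod N\<^esub> ord x = \<one>\<^bsub>G Mod N\<^esub>"
      using Q.pow_mult_distrib[OF comm Nx_closed Nz_closed, of "ord x"] Q.nat_pow_closed[OF Nz_closed, of "ord x"]
      by (metis Q.l_one)
    thus ?thesis using Q.pow_eq_id[OF Nz_closed] by blast
  qed
  moreover have "Q.ord Nz dvd A.ord \<alpha>"
  proof -
    have pow: "N #> (\<alpha> [^]\<^bsub>AutoGroup G\<^esub> k) x = Nx \<otimes>\<^bsub>G Mod N\<^esub> Nz [^]\<^bsub>G Mod N\<^esub> k" for k :: nat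
    proof (induction k)
      case 0
      show ?case using x Nx_closed by (metis A.nat_pow_0 AutoGroup_one Q.nat_pow_0 Q.r_one Nx_def)
    next
      case (Suc k)
      \<comment> \<open>Splitting \<open>\<alpha>\<^sup>k\<^sup>+\<^sup>1\<close> as \<open>\<alpha>\<^sup>k\<close> after \<open>\<alpha>\<close> means that only elements of \<open>G\<close> are mapped,
        so no automorphism induced on the quotient has to be introduced.\<close>
      define \<beta> where "\<beta> = \<alpha> [^]\<^bsub>AutoGroup G\<^esub> k"
      have \<beta>: "\<beta> \<in> carrier (AutoGroup G)" using \<alpha> by (simp add: \<beta>_def)
      have "(\<alpha> [^]\<^bsub>AutoGroup G\<^esub> Suc k) x = \<beta> (x \<otimes> z)"
        using AutoGroup_mult[OF \<beta> \<alpha> x] by (simp add: \<beta>_def \<alpha>x_eq)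
      also have "\<dots> = \<beta> x \<otimes> \<beta> z"
        using AutoGroup_hom[OF \<beta>] x z by (simp add: hom_mult)
      finally have "N #> (\<alpha> [^]\<^bsub>AutoGroup G\<^esub> Suc k) x = (N #> \<beta> x) \<otimes>\<^bsub>G Mod N\<^esub> (N #> \<beta> z)"
        using AutoGroup_closed[OF \<beta>] x z by (simp add: cos_mult del: mult_FactGroup)
      also have "\<dots> = Nx \<otimes>\<^bsub>G Mod N\<^esub> Nz [^]\<^bsub>G Mod N\<^esub> k \<otimes>\<^bsub>G Mod N\<^esub> Nz"
        using Suc fix_z[OF \<beta>] by (simp add: \<beta>_def Nz_def)
      also have "\<dots> = Nx \<otimes>\<^bsub>G Mod N\<^esub> Nz [^]\<^bsub>G Mod N\<^esub> Suc k"
        using Nx_closed Nz_closed by (simp add: Q.m_assoc del: mult_FactGroup)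
      finally show ?case .
    qed
    have "Nx = Nx \<otimes>\<^bsub>G Mod N\<^esub> Nz [^]\<^bsub>G Mod N\<^esub> A.ord \<alpha>"
      using pow[of "A.ord \<alpha>"] A.pow_ord_eq_1[OF \<alpha>] x by (simp add: AutoGroup_one Nx_def)
    hence "Nz [^]\<^bsub>G Mod N\<^esub> A.ord \<alpha> = \<one>\<^bsub>G Mod N\<^esub>"
      using Q.l_cancel_one'[OF Nx_closed Q.nat_pow_closed[OF Nz_closed]] by blast
    thus ?thesis using Q.pow_eq_id[OF Nz_closed] by blast
  qed
  ultimately have "Q.ord Nz = 1"
    using cop by (metis coprime_common_divisor_nat)
  hence "N #> z = N"
    using Q.ord_eq_1[OF Nz_closed] by (simp add: Nz_def)
  thus ?thesis
    using coset_join1[OF _ z] subgroup_axioms by (simp add: z_def)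
qed

lemma autonilpotent_imp_coprime_fixed:
  assumes "autonilpotent G" and x: "x \<in> carrier G" and \<alpha>: "\<alpha> \<in> carrier (AutoGroup G)"
    and cop: "coprime (ord x) (group.ord (AutoGroup G) \<alpha>)"
  shows "\<alpha> x = x"
proof -
  have \<alpha>x: "\<alpha> x \<in> carrier G" using \<alpha> x by (rule AutoGroup_closed)
  have descent: "autocommutator G x \<alpha> \<in> autocentre n G \<Longrightarrow> autocommutator G x \<alpha> = \<one>" for n
  proof (induction n)
    case (Suc n)
    thus ?case
      using autocommutator_descends[OF characteristic_autocentre x \<alpha> cop]
      by (simp add: autocentre_Suc)
  qed (simp add: autocentre_0)
  have "autocommutator G x \<alpha> \<in> carrier G"
    using x \<alpha>x by (simp add: autocommutator_def)
  hence "autocommutator G x \<alpha> = \<one>"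
    using descent assms(1) by (auto simp: autonilpotent_def)
  thus ?thesis
    using x \<alpha>x inv_solve_left[of \<one> x "\<alpha> x"] by (simp add: autocommutator_def)
qed

section \<open>Growth of the series of autocentres\<close>

lemma AutoGroup_acts_on_cosets:
  assumes N: "characteristic_subgroup N G"
  shows "group_action (AutoGroup G) (rcosets N) (\<lambda>\<alpha>. \<lambda>C\<in>rcosets N. \<alpha> ` C)"
proof -
  interpret A: group "AutoGroup G" by (rule AutoGroup)
  have N_sub: "subgroup N G" using N by (simp add: characteristic_subgroup_def)
  have in_G: "C \<subseteq> carrier G" if "C \<in> rcosets N" for C
    using subgroup.rcosets_carrier[OF N_sub is_group that] .
  have closed: "\<alpha> ` C \<in> rcosets N" if \<alpha>: "\<alpha> \<in> carrier (AutoGroup G)" and C: "C \<in> rcosets N" for \<alpha> C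
  proof -
    obtain x where "x \<in> carrier G" "C = N #> x"
      using C by (auto simp: RCOSETS_def)
    thus ?thesis
      using automorphism_image_coset[OF N \<alpha>] AutoGroup_closed[OF \<alpha>]
        rcosetsI[OF subgroup.subset[OF N_sub]] by simp
  qed
  have bij: "(\<lambda>C\<in>rcosets N. \<alpha> ` C) \<in> Bij (rcosets N)" if \<alpha>: "\<alpha> \<in> carrier (AutoGroup G)" for \<alpha>
  proof -
    have "bij_betw (\<lambda>C. \<alpha> ` C) (rcosets N) (rcosets N)"
    proof (rule bij_betw_byWitness[where f' = "\<lambda>C. (inv\<^bsub>AutoGroup G\<^esub> \<alpha>) ` C"])
      show "\<forall>C\<in>rcosets N. (inv\<^bsub>AutoGroup G\<^esub> \<alpha>) ` \<alpha> ` C = C"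
      proof
        fix C assume "C \<in> rcosets N"
        hence "(inv\<^bsub>AutoGroup G\<^esub> \<alpha>) (\<alpha> x) = x" if "x \<in> C" for x
          using in_G AutoGroup_inv(2)[OF \<alpha>] that by blast
        thus "(inv\<^bsub>AutoGroup G\<^esub> \<alpha>) ` \<alpha> ` C = C" by (simp add: image_image)
      qed
      show "\<forall>C\<in>rcosets N. \<alpha> ` (inv\<^bsub>AutoGroup G\<^esub> \<alpha>) ` C = C"
      proof
        fix C assume "C \<in> rcosets N"
        hence "\<alpha> ((inv\<^bsub>AutoGroup G\<^esub> \<alpha>) x) = x" if "x \<in> C" for x
          using in_G AutoGroup_inv(1)[OF \<alpha>] that by blast
        thus "\<alpha> ` (inv\<^bsub>AutoGroup G\<^esub> \<alpha>) ` C = C" by (simp add: image_image)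
      qed
    qed (use \<alpha> closed in auto)
    thus ?thesis by (simp add: Bij_def)
  qed
  have "(\<lambda>\<alpha>. \<lambda>C\<in>rcosets N. \<alpha> ` C) \<in> hom (AutoGroup G) (BijGroup (rcosets N))"
  proof (rule homI)
    fix \<alpha> \<beta> assume \<alpha>: "\<alpha> \<in> carrier (AutoGroup G)" and \<beta>: "\<beta> \<in> carrier (AutoGroup G)"
    have image_mult: "(\<alpha> \<otimes>\<^bsub>AutoGroup G\<^esub> \<beta>) ` C = \<alpha> ` \<beta> ` C" if "C \<in> rcosets N" for C
      unfolding image_image
      by (rule image_cong[OF refl]) (use in_G[OF that] AutoGroup_mult[OF \<alpha> \<beta>] in blast)
    have "(\<lambda>C\<in>rcosets N. \<alpha> ` C) \<otimes>\<^bsub>BijGroup (rcosets N)\<^esub> (\<lambda>C\<in>rcosets N. \<beta> ` C) =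
        compose (rcosets N) (\<lambda>C\<in>rcosets N. \<alpha> ` C) (\<lambda>C\<in>rcosets N. \<beta> ` C)"
      using bij[OF \<alpha>] bij[OF \<beta>] by (simp add: BijGroup_def)
    also have "\<dots> = (\<lambda>C\<in>rcosets N. (\<alpha> \<otimes>\<^bsub>AutoGroup G\<^esub> \<beta>) ` C)"
      unfolding compose_def
    proof (rule restrict_ext)
      fix C assume C: "C \<in> rcosets N"
      thus "(\<lambda>C\<in>rcosets N. \<alpha> ` C) ((\<lambda>C\<in>rcosets N. \<beta> ` C) C) = (\<alpha> \<otimes>\<^bsub>AutoGroup G\<^esub> \<beta>) ` C"
        using closed[OF \<beta> C] image_mult[OF C] by simp
    qed
    finally show "(\<lambda>C\<in>rcosets N. (\<alpha> \<otimes>\<^bsub>AutoGroup G\<^esub> \<beta>) ` C) =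
        (\<lambda>C\<in>rcosets N. \<alpha> ` C) \<otimes>\<^bsub>BijGroup (rcosets N)\<^esub> (\<lambda>C\<in>rcosets N. \<beta> ` C)" by simp
  qed (use bij in \<open>simp add: BijGroup_def\<close>)
  thus ?thesis
    by (simp add: group_action_def group_hom_def group_hom_axioms_def A.is_group group_BijGroup)
qed

text \<open>
  The elements fixed by \<open>B\<close> modulo \<open>N\<close> are the union of the cosets of \<open>N\<close> fixed by \<open>B\<close>.
  The number of these cosets is congruent modulo \<open>p\<close> to the index of \<open>N\<close>, so divisible by \<open>p\<close>.
\<close>
lemma prime_mult_card_dvd_card_fixed_mod:
  assumes fin: "finite (carrier G)" and N: "characteristic_subgroup N G"
    and p: "Factorial_Ring.prime p" "p dvd card (rcosets N)"
    and B: "subgroup B (AutoGroup G)" "card B = p ^ k"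
  shows "p * card N dvd card (fixed_mod G N B)"
proof -
  interpret normal N G using N by (rule characteristic_imp_normal)
  interpret act: group_action "AutoGroup G\<lparr>carrier := B\<rparr>" "rcosets N" "\<lambda>\<alpha>. \<lambda>C\<in>rcosets N. \<alpha> ` C"
    using AutoGroup_acts_on_cosets[OF N] B(1) by (rule group_action.induced_action)
  have B_sub: "B \<subseteq> carrier (AutoGroup G)" using B(1) by (rule subgroup.subset)
  define Fix where "Fix = {C \<in> rcosets N. \<forall>\<alpha>\<in>B. \<alpha> ` C = C}"
  have fin_cosets: "finite (rcosets N)"
    using fin rcosets_subset_PowG[OF subgroup_axioms] by (simp add: finite_subset)
  have "card Fix mod p = card (rcosets N) mod p"
    using act.card_fixed_points_mod_prime[OF p(1) _ fin_cosets] B(2)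
    by (simp add: order_def Fix_def cong: conj_cong)
  hence "p dvd card Fix"
    using p(2) by (simp add: dvd_eq_mod_eq_0)
  moreover have "card N * card Fix = card (fixed_mod G N B)"
  proof -
    have coset_fixed: "N #> x \<in> Fix \<longleftrightarrow> x \<in> fixed_mod G N B" if x: "x \<in> carrier G" for x
    proof -
      have "\<alpha> ` (N #> x) = N #> x \<longleftrightarrow> autocommutator G x \<alpha> \<in> N" if "\<alpha> \<in> B" for \<alpha>
        using that B_sub x automorphism_image_coset[OF N] autocommutator_mem_iff[OF normal_axioms]
        by (metis subsetD)
      thus ?thesis
        using x rcosetsI[OF subset x] by (auto simp: Fix_def fixed_mod_def)
    qed
    have "\<Union>Fix = fixed_mod G N B"
    proof (rule Set.set_eqI)
      fix x
      show "x \<in> \<Union>Fix \<longleftrightarrow> x \<in> fixed_mod G N B"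
      proof
        assume "x \<in> \<Union>Fix"
        then obtain C where C: "C \<in> Fix" "x \<in> C" by blast
        hence "C \<in> rcosets N" by (simp add: Fix_def)
        then obtain y where y: "y \<in> carrier G" "C = N #> y" by (auto simp: RCOSETS_def)
        have xG: "x \<in> carrier G"
          using C(2) y elemrcos_carrier[OF is_group] by blast
        have "C = N #> x"
          using C(2) y repr_independence[OF _ _ subgroup_axioms] by blast
        thus "x \<in> fixed_mod G N B" using C(1) coset_fixed[OF xG] by simp
      next
        assume x: "x \<in> fixed_mod G N B"
        hence xG: "x \<in> carrier G" by (simp add: fixed_mod_def)
        thus "x \<in> \<Union>Fix"
          using x coset_fixed[OF xG] rcos_self[OF xG subgroup_axioms] by blast
      qed
    qed
    moreover have "card N * card Fix = card (\<Union>Fix)"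
    proof (rule card_partition)
      show "finite Fix" using fin_cosets by (simp add: Fix_def)
      show "finite (\<Union>Fix)"
        using fin calculation by (simp add: fixed_mod_def)
      show "card C = card N" if "C \<in> Fix" for C
        using that card_rcosets_equal[OF _ subset, of C] by (simp add: Fix_def)
      show "C \<inter> D = {}" if "C \<in> Fix" "D \<in> Fix" "C \<noteq> D" for C D
        using that rcos_disjoint[OF subgroup_axioms]
        by (auto simp: Fix_def pairwise_def disjnt_def)
    qed
    ultimately show ?thesis by simp
  qed
  ultimately show ?thesis
    by (metis mult.commute mult_dvd_mono dvd_refl)
qed

text \<open>
  Divisibility by \<open>p\<close> of the number of cosets fixed by a Sylow \<open>p\<close>-subgroup \<open>B\<close> yields a
  nontrivial one represented by a \<open>p\<close>-element \<open>x\<close>. Automorphisms of order prime to \<open>p\<close> fix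
  \<open>x\<close> by hypothesis, and together with \<open>B\<close> they generate the automorphism group.
\<close>
lemma fixed_mod_grows:
  assumes fin: "finite (carrier G)" and N: "characteristic_subgroup N G" "N \<noteq> carrier G"
    and fixed: "\<And>\<alpha> x. \<lbrakk>\<alpha> \<in> carrier (AutoGroup G); x \<in> carrier G;
      coprime (ord x) (group.ord (AutoGroup G) \<alpha>)\<rbrakk> \<Longrightarrow> \<alpha> x = x"
  shows "N \<subset> fixed_mod G N (carrier (AutoGroup G))"
proof -
  interpret A: group "AutoGroup G" by (rule AutoGroup)
  interpret normal N G using N(1) by (rule characteristic_imp_normal)
  have finA: "finite (carrier (AutoGroup G))" using fin by (rule finite_AutoGroup)
  have "card (rcosets N) \<noteq> 1"
  proof
    assume "card (rcosets N) = 1"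
    hence "card N = card (carrier G)"
      using lagrange[OF subgroup_axioms] by (simp add: order_def)
    thus False using N(2) fin subset by (metis card_subset_eq)
  qed
  then obtain p where p: "Factorial_Ring.prime p" "p dvd card (rcosets N)"
    using prime_factor_nat by blast
  obtain B where B: "subgroup B (AutoGroup G)"
      "card B = p ^ multiplicity p (order (AutoGroup G))"
    using A.sylow_subgroup_exists[OF finA p(1)] .
  define F where "F = fixed_mod G N B"
  have B_sub: "B \<subseteq> carrier (AutoGroup G)" using B(1) by (rule subgroup.subset)
  have F: "subgroup F G"
    unfolding F_def using normal_axioms B_sub by (rule subgroup_fixed_mod)
  have finF: "finite F" using F fin subgroup.subset finite_subset by metis
  interpret F: group "G\<lparr>carrier := F\<rparr>" using F by (rule subgroup_imp_group)
  obtain S where S_F: "subgroup S (G\<lparr>carrier := F\<rparr>)"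
      and card_S: "card S = p ^ multiplicity p (card F)"
    using F.sylow_subgroup_exists[of p] p(1) finF by (auto simp: order_def)
  have S: "subgroup S G" using F S_F by (rule incl_subgroup)
  \<comment> \<open>The order of \<open>F\<close> contains at least one more factor \<open>p\<close> than that of \<open>N\<close>.\<close>
  have "\<not> S \<subseteq> N"
  proof
    assume "S \<subseteq> N"
    hence "card S dvd card N"
      using S subgroup_axioms by (intro card_subgroup_dvd_of_subset)
    hence "p * card S dvd card F"
      using prime_mult_card_dvd_card_fixed_mod[OF fin N(1) p B] unfolding F_def
      by (meson dvd_refl dvd_trans mult_dvd_mono)
    hence "p ^ Suc (multiplicity p (card F)) dvd card F"
      by (simp add: card_S)
    moreover have "card F \<noteq> 0"
      using finF subgroup.one_closed[OF F] by auto
    ultimately show False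
      using p(1) by (metis Suc_n_not_le_n not_prime_unit power_dvd_iff_le_multiplicity)
  qed
  then obtain x where x: "x \<in> S" "x \<notin> N" by blast
  have xF: "x \<in> F" using x S_F subgroup.subset by fastforce
  have xG: "x \<in> carrier G" using xF by (simp add: F_def fixed_mod_def)
  have ord_x: "ord x dvd p ^ multiplicity p (card F)"
    using ord_dvd_card_subgroup[OF S x(1)] card_S by simp
  define T where "T = {\<alpha> \<in> carrier (AutoGroup G). autocommutator G x \<alpha> \<in> N}"
  have "subgroup T (AutoGroup G)"
  proof -
    interpret act: group_action "AutoGroup G" "rcosets N" "\<lambda>\<alpha>. \<lambda>C\<in>rcosets N. \<alpha> ` C"
      using N(1) by (rule AutoGroup_acts_on_cosets)
    have "T = stabilizer (AutoGroup G) (\<lambda>\<alpha>. \<lambda>C\<in>rcosets N. \<alpha> ` C) (N #> x)"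
      using rcosetsI[OF subset xG] automorphism_image_coset[OF N(1) _ xG]
        autocommutator_mem_iff[OF normal_axioms _ xG]
      by (auto simp: T_def stabilizer_def)
    thus ?thesis
      using act.stabilizer_subgroup rcosetsI[OF subset xG] by simp
  qed
  hence "T = carrier (AutoGroup G)"
  proof (rule A.subgroup_eq_carrier_of_sylows[OF finA])
    fix q :: nat assume q: "Factorial_Ring.prime q"
    show "\<exists>S. subgroup S (AutoGroup G) \<and> S \<subseteq> T \<and>
        card S = q ^ multiplicity q (order (AutoGroup G))"
    proof (cases "q = p")
      case True
      have "B \<subseteq> T" using xF B_sub by (auto simp: T_def F_def fixed_mod_def)
      thus ?thesis using B True by blast
    next
      case False
      obtain R where R: "subgroup R (AutoGroup G)"
          "card R = q ^ multiplicity q (order (AutoGroup G))"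
        using A.sylow_subgroup_exists[OF finA q] .
      have "R \<subseteq> T"
      proof
        fix \<alpha> assume "\<alpha> \<in> R"
        hence \<alpha>: "\<alpha> \<in> carrier (AutoGroup G)" using R(1) subgroup.subset by blast
        have "A.ord \<alpha> dvd q ^ multiplicity q (order (AutoGroup G))"
          using A.ord_dvd_card_subgroup[OF R(1) \<open>\<alpha> \<in> R\<close>] R(2) by simp
        moreover have "coprime (p ^ multiplicity p (card F))
            (q ^ multiplicity q (order (AutoGroup G)))"
          using primes_coprime[OF p(1) q] False by simp
        ultimately have "coprime (ord x) (A.ord \<alpha>)"
          using ord_x coprime_divisors by blast
        hence "\<alpha> x = x" by (rule fixed[OF \<alpha> xG])
        hence "autocommutator G x \<alpha> = \<one>"
          using xG by (simp add: autocommutator_def)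
        thus "\<alpha> \<in> T" using \<alpha> by (simp add: T_def)
      qed
      thus ?thesis using R by blast
    qed
  qed
  hence "x \<in> fixed_mod G N (carrier (AutoGroup G))"
    using xG by (auto simp: T_def fixed_mod_def)
  thus ?thesis
    using x(2) subset_fixed_mod[OF N(1) subset_refl] by blast
qed

text \<open>
  If no autocentre were the whole group, the strictly ascending chain would force the
  \<open>n\<close>-th one to have at least \<open>n\<close> elements.
\<close>
lemma coprime_fixed_imp_autonilpotent:
  assumes fin: "finite (carrier G)"
    and fixed: "\<And>\<alpha> x. \<lbrakk>\<alpha> \<in> carrier (AutoGroup G); x \<in> carrier G;
      coprime (ord x) (group.ord (AutoGroup G) \<alpha>)\<rbrakk> \<Longrightarrow> \<alpha> x = x"
  shows "autonilpotent G"
proof (rule ccontr)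
  assume "\<not> autonilpotent G"
  hence proper: "autocentre n G \<noteq> carrier G" for n
    by (auto simp: autonilpotent_def)
  have finite_autocentre: "finite (autocentre n G)" for n
    using fin by (simp add: autocentre_def)
  have lower: "n \<le> card (autocentre n G)" for n
  proof (induction n)
    case (Suc n)
    have "autocentre n G \<subset> autocentre (Suc n) G"
      unfolding autocentre_Suc
      by (intro fixed_mod_grows fin characteristic_autocentre proper fixed)
    hence "card (autocentre n G) < card (autocentre (Suc n) G)"
      using finite_autocentre by (intro psubset_card_mono)
    with Suc show ?case by simp
  qed simp
  have upper: "card (autocentre n G) \<le> card (carrier G)" for n
    using fin by (intro card_mono) (auto simp: autocentre_def)
  show False
    using lower[of "Suc (card (carrier G))"] upper[of "Suc (card (carrier G))"] by simp
qed

end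

theorem corollary1p2:
  fixes G :: "('a, 'b) monoid_scheme"
  assumes "group G" and "finite (carrier G)"
  shows "autonilpotent G \<longleftrightarrow>
    (\<forall>\<alpha> \<in> carrier (AutoGroup G). \<forall>x \<in> carrier G.
       coprime (group.ord G x) (group.ord (AutoGroup G) \<alpha>) \<longrightarrow> \<alpha> x = x)"
  using group.autonilpotent_imp_coprime_fixed[OF assms(1)]
    group.coprime_fixed_imp_autonilpotent[OF assms] by blast

end
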